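(* Let $V:\mathfrak{C}\to\mathfrak{U}$ be a game value map, where $v_T,w_\lambda\in\mathfrak{C}$ for all $T,\lambda>0$. Let a family of functions $U_\lambda\in\mathfrak{U}$ $(\lambda>0)$ be a supersolution for the payoffs $w_\lambda$, and let the family of functions $V[v_T]$ $(T>0)$ be a subsolution for the payoffs $v_T$. Further, let $U_\lambda$ $(\lambda>0)$ satisfy $$\limsup_{\lambda\downarrow0}\ \sup_{p\in[1,p_0]}\ \sup_{\omega\in\Omega}\big(U_{p\lambda}(\omega)-U_\lambda(\omega)\big)\le 0\qquad\forall p_0>1.$$ Then for every $\varepsilon>0$ there exists a natural $N$ such that $$V[v_T](\omega)\le U_{1/T}(\omega)+\varepsilon\qquad\forall\omega\in\Omega,\ T>N.$$
   Context: Setting: $\mathbb{R}_+=[0,\infty)$. $\Omega$ is a nonempty set; $\mathbb{K}$ is a nonempty set of maps from $\mathbb{R}_+$ to $\Omega$; $g:\Omega\to[0,1]$ is such that for every $z\in\mathbb{K}$ the map $t\mapsto g(z(t))$ is Borel measurable. For $T,\lambda>0$ and $z\in\mathbb{K}$, $$v_T(z)=\frac1T\int_0^T g(z(t))\,dt,\qquad w_\lambda(z)=\lambda\int_0^\infty e^{-\lambda t}g(z(t))\,dt .$$ Game value map: $\mathfrak{U}$ is the set of all bounded maps $\Omega\to\mathbb{R}$. $\mathfrak{C}$ is a nonempty set of maps $\mathbb{K}\to\mathbb{R}$ such that $Ac+B\in\mathfrak{C}$ for all $c\in\mathfrak{C}$, $A\ge0$, $B\in\mathbb{R}$. A map $V:\mathfrak{C}\to\mathfrak{U}$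 is a game value map if (1) $V[Ac+B]=A\,V[c]+B$ for all $c\in\mathfrak{C}$, $A\ge 0$, $B\in\mathbb{R}$; and (2) for $c_1,c_2\in\mathfrak{C}$, if $c_1(z)\le c_2(z)$ for all $z\in\mathbb{K}$ then $V[c_1](\omega)\le V[c_2](\omega)$ for all $\omega\in\Omega$. Auxiliary payoffs: for $\lambda,T,h>0$ and $U_*:\Omega\to\mathbb{R}$, define for $z\in\mathbb{K}$ $$\zeta^{U_*}_{h,T}(z)=\frac{1}{T+h}\int_0^h g(z(t))\,dt+\frac{T}{T+h}U_*(z(h)),\qquad \xi^{U_*}_{h,\lambda}(z)=\lambda\int_0^h e^{-\lambda t}g(z(t))\,dt+e^{-\lambda h}U_*(z(h)).$$ Sub-/supersolutions: A family $U_T\in\mathfrak{U}$ $(T>0)$ is a subsolution (supersolution) for the payoffs $v_T$ $(T>0)$ if for every $\varepsilon>0$ there is a natural $\bar T$ such that for all natural $h,T>\bar T$ the payoff $\zeta^{U_T}_{h,T}$ lies in $\mathfrak{C}$ and $U_{T+h}\le V[\zeta^{U_T}_{h,T}]+\varepsilon$ (respectively $U_{T+h}\ge V[\zeta^{U_T}_{h,T}]-\varepsilon$) on $\Omega$. A family $U_\lambda\in\mathfrak{U}$ $(\lambda>0)$ is a subsolution (supersolution) for the payoffs $w_\lambda$ $(\lambda>0)$ if for every $\varepsilon>0$ there is a natural $\bar T$ such that for all natural $h>\bar T$ and all positive $\lambda<1/\bar T$ the payoff $\xi^{U_\lambda}_{h,\lambda}$ lies in $\mathfrak{C}$ and $U_\lambda\le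 V[\xi^{U_\lambda}_{h,\lambda}]+\varepsilon$ (respectively $U_\lambda\ge V[\xi^{U_\lambda}_{h,\lambda}]-\varepsilon$) on $\Omega$. *)

theory Defs
  imports "HOL-Analysis.Analysis"
begin

text \<open>
  A map between sets is an extensional function (\<open>\<rightarrow>\<^sub>E\<close>), so that equality of functions is
  equality on the intended domain: trajectories live in \<open>{0..} \<rightarrow>\<^sub>E \<Omega>\<close>, payoffs in
  \<open>K \<rightarrow>\<^sub>E UNIV\<close>, and value functions in \<open>\<Omega> \<rightarrow>\<^sub>E UNIV\<close>.
\<close>

definition bounded_maps :: "'w set \<Rightarrow> ('w \<Rightarrow> real) set" where
  "bounded_maps \<Omega> = {u \<in> \<Omega> \<rightarrow>\<^sub>E UNIV. bounded (u ` \<Omega>)}"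

definition trajectory_setting :: "'w set \<Rightarrow> (real \<Rightarrow> 'w) set \<Rightarrow> ('w \<Rightarrow> real) \<Rightarrow> bool" where
  "trajectory_setting \<Omega> K g \<longleftrightarrow>
     \<Omega> \<noteq> {} \<and> K \<noteq> {} \<and> K \<subseteq> {0..} \<rightarrow>\<^sub>E \<Omega> \<and> g \<in> \<Omega> \<rightarrow> {0..1} \<and>
     (\<forall>z\<in>K. (\<lambda>t. g (z t)) \<in> borel_measurable (restrict_space borel {0..}))"

definition v_payoff ::
  "(real \<Rightarrow> 'w) set \<Rightarrow> ('w \<Rightarrow> real) \<Rightarrow> real \<Rightarrow> (real \<Rightarrow> 'w) \<Rightarrow> real" where
  "v_payoff K g T = (\<lambda>z\<in>K. 1 / T * (LINT t:{0..T}|lborel. g (z t)))"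

definition w_payoff ::
  "(real \<Rightarrow> 'w) set \<Rightarrow> ('w \<Rightarrow> real) \<Rightarrow> real \<Rightarrow> (real \<Rightarrow> 'w) \<Rightarrow> real" where
  "w_payoff K g l = (\<lambda>z\<in>K. l * (LINT t:{0..}|lborel. exp (- l * t) * g (z t)))"

definition zeta_payoff ::
  "(real \<Rightarrow> 'w) set \<Rightarrow> ('w \<Rightarrow> real) \<Rightarrow> ('w \<Rightarrow> real) \<Rightarrow> real \<Rightarrow> real
     \<Rightarrow> (real \<Rightarrow> 'w) \<Rightarrow> real" where
  "zeta_payoff K g u h T =
     (\<lambda>z\<in>K. 1 / (T + h) * (LINT t:{0..h}|lborel. g (z t)) + T / (T + h) * u (z h))"

definition xi_payoff ::
  "(real \<Rightarrow> 'w) set \<Rightarrow> ('w \<Rightarrow> real) \<Rightarrow> ('w \<Rightarrow> real) \<Rightarrow> real \<Rightarrow> real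
     \<Rightarrow> (real \<Rightarrow> 'w) \<Rightarrow> real" where
  "xi_payoff K g u h l =
     (\<lambda>z\<in>K. l * (LINT t:{0..h}|lborel. exp (- l * t) * g (z t)) + exp (- l * h) * u (z h))"

definition payoff_class :: "(real \<Rightarrow> 'w) set \<Rightarrow> ((real \<Rightarrow> 'w) \<Rightarrow> real) set \<Rightarrow> bool" where
  "payoff_class K C \<longleftrightarrow>
     C \<noteq> {} \<and> C \<subseteq> K \<rightarrow>\<^sub>E UNIV \<and>
     (\<forall>c\<in>C. \<forall>A\<ge>0. \<forall>B. (\<lambda>z\<in>K. A * c z + B) \<in> C)"

definition game_value_map ::
  "'w set \<Rightarrow> (real \<Rightarrow> 'w) set \<Rightarrow> ((real \<Rightarrow> 'w) \<Rightarrow> real) set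
     \<Rightarrow> (((real \<Rightarrow> 'w) \<Rightarrow> real) \<Rightarrow> 'w \<Rightarrow> real) \<Rightarrow> bool" where
  "game_value_map \<Omega> K C V \<longleftrightarrow>
     V \<in> C \<rightarrow> bounded_maps \<Omega> \<and>
     (\<forall>c\<in>C. \<forall>A\<ge>0. \<forall>B. V (\<lambda>z\<in>K. A * c z + B) = (\<lambda>\<omega>\<in>\<Omega>. A * V c \<omega> + B)) \<and>
     (\<forall>c1\<in>C. \<forall>c2\<in>C. (\<forall>z\<in>K. c1 z \<le> c2 z) \<longrightarrow> (\<forall>\<omega>\<in>\<Omega>. V c1 \<omega> \<le> V c2 \<omega>))"

text \<open>
  The threshold \<open>Tb\<close> is a positive natural: as \<open>1 / 0 = 0\<close>, allowing \<open>Tb = 0\<close> would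
  make the condition for the payoffs \<open>w\<close> vacuous. The families are indexed by all positive reals,
  although \<open>h\<close> (and \<open>T\<close>) range only over naturals.
\<close>

definition subsolution_v ::
  "'w set \<Rightarrow> (real \<Rightarrow> 'w) set \<Rightarrow> ('w \<Rightarrow> real) \<Rightarrow> ((real \<Rightarrow> 'w) \<Rightarrow> real) set
     \<Rightarrow> (((real \<Rightarrow> 'w) \<Rightarrow> real) \<Rightarrow> 'w \<Rightarrow> real) \<Rightarrow> (real \<Rightarrow> 'w \<Rightarrow> real) \<Rightarrow> bool" where
  "subsolution_v \<Omega> K g C V U \<longleftrightarrow>
     (\<forall>T>0. U T \<in> bounded_maps \<Omega>) \<and>
     (\<forall>\<epsilon>>0. \<exists>Tb::nat. Tb \<ge> 1 \<and> (\<forall>h T :: nat. h > Tb \<and> T > Tb \<longrightarrow>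
        zeta_payoff K g (U (real T)) (real h) (real T) \<in> C \<and>
        (\<forall>\<omega>\<in>\<Omega>. U (real T + real h) \<omega>
                \<le> V (zeta_payoff K g (U (real T)) (real h) (real T)) \<omega> + \<epsilon>)))"

definition supersolution_w ::
  "'w set \<Rightarrow> (real \<Rightarrow> 'w) set \<Rightarrow> ('w \<Rightarrow> real) \<Rightarrow> ((real \<Rightarrow> 'w) \<Rightarrow> real) set
     \<Rightarrow> (((real \<Rightarrow> 'w) \<Rightarrow> real) \<Rightarrow> 'w \<Rightarrow> real) \<Rightarrow> (real \<Rightarrow> 'w \<Rightarrow> real) \<Rightarrow> bool" where
  "supersolution_w \<Omega> K g C V U \<longleftrightarrow>
     (\<forall>l>0. U l \<in> bounded_maps \<Omega>) \<and>
     (\<forall>\<epsilon>>0. \<exists>Tb::nat. Tb \<ge> 1 \<and> (\<forall>(h::nat) (l::real). h > Tb \<and> 0 < l \<and> l < 1 / real Tb \<longrightarrow>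
        xi_payoff K g (U l) (real h) l \<in> C \<and>
        (\<forall>\<omega>\<in>\<Omega>. U l \<omega> \<ge> V (xi_payoff K g (U l) (real h) l) \<omega> - \<epsilon>)))"

end

theory Submission
  imports Defs
begin

text \<open>
  Put \<open>d(n) = sup (V[v\<^sub>n] - U\<^bsub>1/n\<^esub>)\<close> and split \<open>n = m + h\<close> with \<open>s = h/n\<close> small. With
  \<open>\<lambda> = 1/n\<close> the payoffs \<open>\<zeta>\<close> (continued from \<open>m\<close>) and \<open>\<xi>\<close> differ, apart from their terminal
  values, by \<open>O(s\<^sup>2)\<close>, since \<open>1 - s \<le> e\<^sup>-\<^sup>s \<le> 1 - s + s\<^sup>2\<close>; here one uses that supersolutions are
  asymptotically bounded below by \<open>0\<close>. Hence \<open>d(n) \<le> (1 - s) d(m) + O(s\<^sup>2) + o(1)\<close>, where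
  the \<open>o(1)\<close> term absorbs the passage from \<open>U\<^bsub>1/m\<^esub>\<close> to \<open>U\<^bsub>1/n\<^esub>\<close>. Iterating with \<open>s\<close> of
  constant order gives \<open>limsup d = O(s)\<close>, and \<open>s\<close> is arbitrary. Non-integer horizons are compared
  with their integer parts.
\<close>

section \<open>Integrals over \<open>{0..h}\<close> of functions with values in
  \<open>{0..1}\<close>\<close>

lemma set_integrable_lborel_Icc_unit_bounded:
  fixes f :: "real \<Rightarrow> real"
  assumes "f \<in> borel_measurable (restrict_space borel {0..})"
    and "\<And>t. t \<ge> 0 \<Longrightarrow> f t \<in> {0..1}"
  shows "set_integrable lborel {0..h} f"
  unfolding set_integrable_def
proof (rule Bochner_Integration.integrable_bound)
  show "integrable lborel (\<lambda>t. indicator {0..h} t :: real)"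
    by (simp add: emeasure_lborel_Icc_eq)
  \<comment> \<open>Measurability is given on the half-line only; extending by zero transfers it to
    the whole line before cutting down to \<open>{0..h}\<close>.\<close>
  have "(\<lambda>t. indicator {0..} t *\<^sub>R f t) \<in> borel_measurable borel"
    using assms(1) by (subst (asm) borel_measurable_restrict_space_iff) auto
  then have "(\<lambda>t. indicator {0..h} t *\<^sub>R (indicator {0..} t *\<^sub>R f t)) \<in> borel_measurable borel"
    by measurable
  also have "(\<lambda>t. indicator {0..h} t *\<^sub>R (indicator {0..} t *\<^sub>R f t))
      = (\<lambda>t. indicator {0..h} t *\<^sub>R f t)"
    by (auto simp: indicator_def)
  finally show "(\<lambda>t. indicator {0..h} t *\<^sub>R f t) \<in> borel_measurable lborel"
    by simp
  show "AE t in lborel. norm (indicator {0..h} t *\<^sub>R f t) \<le> norm (indicator {0..h} t :: real)"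
    using assms(2) by (auto simp: indicator_def)
qed

lemma set_lebesgue_integral_Icc_le_add:
  fixes f :: "real \<Rightarrow> real"
  assumes "f \<in> borel_measurable (restrict_space borel {0..})"
    and "\<And>t. t \<ge> 0 \<Longrightarrow> f t \<in> {0..1}" and "0 \<le> a" "a \<le> b"
  shows "(LINT t:{0..b}|lborel. f t) \<le> (LINT t:{0..a}|lborel. f t) + (b - a)"
proof -
  have int: "integrable lborel (\<lambda>t. indicator {0..h} t *\<^sub>R f t)" for h
    using set_integrable_lborel_Icc_unit_bounded[OF assms(1,2)] by (simp add: set_integrable_def)
  have int1: "integrable lborel (\<lambda>t. indicator {a..b} t :: real)"
    by (simp add: emeasure_lborel_Icc_eq)
  have "(LINT t:{0..b}|lborel. f t)
      \<le> (LINT t|lborel. indicator {0..a} t *\<^sub>R f t + indicator {a..b} t)"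
    unfolding set_lebesgue_integral_def
    using assms(2) by (intro integral_mono int Bochner_Integration.integrable_add int1)
      (auto simp: indicator_def)
  also have "\<dots> = (LINT t:{0..a}|lborel. f t) + (b - a)"
    unfolding set_lebesgue_integral_def
    using assms(4) by (subst Bochner_Integration.integral_add[OF int int1]) simp
  finally show ?thesis .
qed

lemma set_lebesgue_integral_Icc_nonneg:
  fixes f :: "real \<Rightarrow> real"
  assumes "\<And>t. t \<ge> 0 \<Longrightarrow> f t \<in> {0..1}"
  shows "0 \<le> (LINT t:{0..h}|lborel. f t)"
  unfolding set_lebesgue_integral_def
  using assms by (intro Bochner_Integration.integral_nonneg) (auto simp: indicator_def)

lemma set_lebesgue_integral_Icc_le:
  fixes f :: "real \<Rightarrow> real"
  assumes "f \<in> borel_measurable (restrict_space borel {0..})"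
    and "\<And>t. t \<ge> 0 \<Longrightarrow> f t \<in> {0..1}" and "0 \<le> h"
  shows "(LINT t:{0..h}|lborel. f t) \<le> h"
proof -
  have "(LINT t:{0..0::real}|lborel. f t) = 0"
    unfolding set_lebesgue_integral_def
    by (rule integral_eq_zero_AE, rule AE_mp[OF AE_lborel_singleton[of 0]]) auto
  then show ?thesis
    using set_lebesgue_integral_Icc_le_add[OF assms(1,2), of 0 h] assms(3) by simp
qed

text \<open>On \<open>{0..h}\<close> the discount factor is at least \<open>1 - l * t\<close>, hence
  at least the constant \<open>1 - l * h\<close>. This makes the running part of
  \<open>xi_payoff\<close> comparable with that of \<open>zeta_payoff\<close>.\<close>

lemma discounted_integral_ge:
  fixes f :: "real \<Rightarrow> real"
  assumes "f \<in> borel_measurable (restrict_space borel {0..})"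
    and "\<And>t. t \<ge> 0 \<Longrightarrow> f t \<in> {0..1}" and "0 \<le> l"
  shows "(1 - l * h) * (LINT t:{0..h}|lborel. f t)
    \<le> (LINT t:{0..h}|lborel. exp (- l * t) * f t)"
proof -
  have m: "(\<lambda>t. exp (- l * t) * f t) \<in> borel_measurable (restrict_space borel {0..})"
    by (intro borel_measurable_times[OF measurable_restrict_space1 assms(1)]) measurable
  have b: "exp (- l * t) * f t \<in> {0..1}" if "t \<ge> 0" for t
    using assms(2)[OF that] assms(3) that by (auto intro!: mult_le_one)
  have "(1 - l * h) * (LINT t:{0..h}|lborel. f t) = (LINT t:{0..h}|lborel. (1 - l * h) * f t)"
    by simp
  also have "\<dots> \<le> (LINT t:{0..h}|lborel. exp (- l * t) * f t)"
  proof (rule set_integral_mono)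
    show "set_integrable lborel {0..h} (\<lambda>t. (1 - l * h) * f t)"
      using set_integrable_lborel_Icc_unit_bounded[OF assms(1,2)] by simp
    show "set_integrable lborel {0..h} (\<lambda>t. exp (- l * t) * f t)"
      by (rule set_integrable_lborel_Icc_unit_bounded[OF m b])
    show "(1 - l * h) * f t \<le> exp (- l * t) * f t" if "t \<in> {0..h}" for t
    proof (rule mult_right_mono)
      have "1 - l * h \<le> 1 + (- l * t)"
        using that assms(3) by (simp add: mult_left_mono)
      also have "\<dots> \<le> exp (- l * t)"
        by (rule exp_ge_add_one_self)
      finally show "1 - l * h \<le> exp (- l * t)" .
    qed (use assms(2) that in auto)
  qed
  finally show ?thesis .
qed

section \<open>Scalar estimates for a single step\<close>

lemma exp_uminus_le_quadratic:
  fixes s :: real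
  assumes "0 \<le> s"
  shows "exp (- s) \<le> 1 - s + s\<^sup>2"
proof -
  have "exp (- s) \<le> 1 / (1 + s)"
    using exp_ge_add_one_self[of s] assms by (simp add: exp_minus divide_simps)
  \<comment> \<open>Indeed \<open>(1 + s) * (1 - s + s^2) = 1 + s^3\<close>, which is at least
    1.\<close>
  also have "\<dots> \<le> 1 - s + s\<^sup>2"
    using assms by (simp add: divide_simps algebra_simps power2_eq_square)
  finally show ?thesis .
qed

text \<open>\<open>I\<close> and \<open>J\<close> stand for the plain and the discounted integral,
  \<open>w\<close> and \<open>u\<close> for the two terminal values. Each comparison costs at most
  \<open>s^2\<close>: the running parts because \<open>l * I\<close> exceeds \<open>l * J\<close> by
  at most \<open>s * (l * h)\<close>, the terminal weights because
  \<open>exp (- s) - (1 - s)\<close> lies between 0 and \<open>s^2\<close> and \<open>u\<close> is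
  at least -1.\<close>

lemma one_step_estimate:
  fixes s l h I J w u D \<delta> :: real
  assumes "0 \<le> s" "s \<le> 1" "0 \<le> l" "l * h = s" "I \<le> h" "(1 - s) * I \<le> J"
    and "w \<le> u + D + \<delta>" "0 \<le> \<delta>" "-1 \<le> u"
  shows "l * I + (1 - s) * w \<le> l * J + exp (- s) * u + ((1 - s) * D + \<delta> + 2 * s\<^sup>2)"
proof -
  have "l * ((1 - s) * I) \<le> l * J"
    using assms by (intro mult_left_mono)
  moreover have "s * (l * I) \<le> s * (l * h)"
    using assms by (intro mult_left_mono)
  ultimately have 1: "l * I \<le> l * J + s\<^sup>2"
    by (simp add: assms(4) left_diff_distrib right_diff_distrib power2_eq_square mult.left_commute)
  have 2: "(1 - s) * w \<le> (1 - s) * (u + D + \<delta>)"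
    using assms by (intro mult_left_mono) auto
  have "0 \<le> exp (- s) - (1 - s)"
    using exp_ge_add_one_self[of "- s"] by simp
  then have "(exp (- s) - (1 - s)) * (-1) \<le> (exp (- s) - (1 - s)) * u"
    using assms by (intro mult_left_mono)
  moreover have "0 \<le> s * \<delta>"
    using assms by simp
  ultimately show ?thesis
    using 1 2 exp_uminus_le_quadratic[OF assms(1)] by (simp add: algebra_simps)
qed

section \<open>Consequences of the axioms of a game value map\<close>

locale value_map =
  fixes \<Omega> :: "'w set" and K :: "(real \<Rightarrow> 'w) set" and g :: "'w \<Rightarrow> real"
    and C :: "((real \<Rightarrow> 'w) \<Rightarrow> real) set"
    and V :: "((real \<Rightarrow> 'w) \<Rightarrow> real) \<Rightarrow> 'w \<Rightarrow> real"
  assumes setting: "trajectory_setting \<Omega> K g"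
    and payoffs: "payoff_class K C"
    and game: "game_value_map \<Omega> K C V"
begin

lemma trajectory_in: "z \<in> K \<Longrightarrow> t \<ge> 0 \<Longrightarrow> z t \<in> \<Omega>"
  using setting by (auto simp: trajectory_setting_def PiE_def Pi_def)

lemma running_measurable:
  "z \<in> K \<Longrightarrow> (\<lambda>t. g (z t)) \<in> borel_measurable (restrict_space borel {0..})"
  using setting by (auto simp: trajectory_setting_def)

lemma running_unit: "z \<in> K \<Longrightarrow> t \<ge> 0 \<Longrightarrow> g (z t) \<in> {0..1}"
  using setting trajectory_in[of z t] by (auto simp: trajectory_setting_def Pi_def)

lemma affine_in_class: "c \<in> C \<Longrightarrow> 0 \<le> A \<Longrightarrow> (\<lambda>z\<in>K. A * c z + B) \<in> C"
  using payoffs by (auto simp: payoff_class_def)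

lemma value_affine:
  "c \<in> C \<Longrightarrow> 0 \<le> A \<Longrightarrow> \<omega> \<in> \<Omega> \<Longrightarrow> V (\<lambda>z\<in>K. A * c z + B) \<omega> = A * V c \<omega> + B"
  using game by (auto simp: game_value_map_def)

lemma value_mono:
  "c1 \<in> C \<Longrightarrow> c2 \<in> C \<Longrightarrow> (\<And>z. z \<in> K \<Longrightarrow> c1 z \<le> c2 z) \<Longrightarrow> \<omega> \<in> \<Omega> \<Longrightarrow> V c1 \<omega> \<le> V c2 \<omega>"
  using game unfolding game_value_map_def by blast

lemma value_le_add:
  assumes "c1 \<in> C" "c2 \<in> C" "\<And>z. z \<in> K \<Longrightarrow> c1 z \<le> c2 z + B" "\<omega> \<in> \<Omega>"
  shows "V c1 \<omega> \<le> V c2 \<omega> + B"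
  using value_mono[OF assms(1) affine_in_class[OF assms(2), of 1 B] _ assms(4)]
    value_affine[OF assms(2) _ assms(4), of 1 B] assms(3) by simp

text \<open>Taking \<open>A = 0\<close> in the affine rule puts every constant payoff into
  \<open>C\<close> and gives it that constant as value, so monotonicity applies.\<close>

lemma value_le_const:
  assumes "c \<in> C" "\<And>z. z \<in> K \<Longrightarrow> c z \<le> B" "\<omega> \<in> \<Omega>"
  shows "V c \<omega> \<le> B"
  using value_mono[OF assms(1) affine_in_class[OF assms(1), of 0 B] _ assms(3)]
    value_affine[OF assms(1) _ assms(3), of 0 B] assms(2) by simp

lemma value_ge_const:
  assumes "c \<in> C" "\<And>z. z \<in> K \<Longrightarrow> B \<le> c z" "\<omega> \<in> \<Omega>"
  shows "B \<le> V c \<omega>"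
  using value_mono[OF affine_in_class[OF assms(1), of 0 B] assms(1) _ assms(3)]
    value_affine[OF assms(1) _ assms(3), of 0 B] assms(2) by simp

lemma value_v_payoff_le_one:
  assumes "v_payoff K g T \<in> C" "T > 0" "\<omega> \<in> \<Omega>"
  shows "V (v_payoff K g T) \<omega> \<le> 1"
proof (rule value_le_const[OF assms(1) _ assms(3)])
  fix z assume z: "z \<in> K"
  show "v_payoff K g T z \<le> 1"
    using set_lebesgue_integral_Icc_le[OF running_measurable[OF z] running_unit[OF z], of T] z assms(2)
    by (simp add: v_payoff_def)
qed

text \<open>Replacing \<open>1 / T\<close> by \<open>1 / S\<close> only enlarges the average, and
  the piece of the integral after \<open>S\<close> contributes at most \<open>T - S\<close>. This
  later compares a real horizon with its integer part.\<close>

lemma value_v_payoff_le_shorter: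
  assumes "v_payoff K g S \<in> C" "v_payoff K g T \<in> C" "0 < S" "S \<le> T" "\<omega> \<in> \<Omega>"
  shows "V (v_payoff K g T) \<omega> \<le> V (v_payoff K g S) \<omega> + (T - S) / S"
proof (rule value_le_add[OF assms(2,1) _ assms(5)])
  fix z assume z: "z \<in> K"
  let ?I = "\<lambda>a. LINT t:{0..a}|lborel. g (z t)"
  have I: "?I T \<le> ?I S + (T - S)" "0 \<le> ?I T"
    using set_lebesgue_integral_Icc_le_add[OF running_measurable[OF z] running_unit[OF z], of S T]
      set_lebesgue_integral_Icc_nonneg[OF running_unit[OF z]] assms by auto
  have "?I T / T \<le> ?I T / S"
    using I assms by (intro divide_left_mono) auto
  also have "\<dots> \<le> (?I S + (T - S)) / S"
    using I assms by (intro divide_right_mono) auto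
  finally show "v_payoff K g T z \<le> v_payoff K g S z + (T - S) / S"
    using z by (simp add: v_payoff_def add_divide_distrib)
qed

text \<open>The running part of \<open>xi_payoff\<close> is nonnegative and its terminal part is at
  least \<open>- exp (- l * h) * B\<close>, where \<open>B\<close> bounds \<open>U l\<close>. For
  fixed \<open>l\<close> the supersolution inequality holds for all large \<open>h\<close> with the
  same \<open>\<epsilon>\<close>, so \<open>h\<close> can tend to infinity; that \<open>B\<close>
  depends on \<open>l\<close> does no harm.\<close>

lemma supersolution_lower_bound:
  assumes "supersolution_w \<Omega> K g C V U" "0 < \<epsilon>"
  obtains N :: nat where "N \<ge> 1" "\<And>l \<omega>. 0 < l \<Longrightarrow> l < 1 / real N \<Longrightarrow> \<omega> \<in> \<Omega> \<Longrightarrow> - \<epsilon> \<le> U l \<omega>"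
proof -
  obtain N :: nat where N: "N \<ge> 1"
    and sup: "\<And>(h::nat) l. h > N \<Longrightarrow> 0 < l \<Longrightarrow> l < 1 / real N \<Longrightarrow>
      xi_payoff K g (U l) (real h) l \<in> C \<and>
      (\<forall>\<omega>\<in>\<Omega>. U l \<omega> \<ge> V (xi_payoff K g (U l) (real h) l) \<omega> - \<epsilon>)"
    using assms(1)[unfolded supersolution_w_def, THEN conjunct2, rule_format, OF assms(2)]
    by metis
  have "- \<epsilon> \<le> U l \<omega>" if l: "0 < l" "l < 1 / real N" and \<omega>: "\<omega> \<in> \<Omega>" for l \<omega>
  proof -
    have "bounded (U l ` \<Omega>)"
      using assms(1) l by (auto simp: supersolution_w_def bounded_maps_def)
    then obtain B where B: "\<And>x. x \<in> \<Omega> \<Longrightarrow> \<bar>U l x\<bar> \<le> B"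
      by (auto simp: bounded_iff)
    have ge: "- exp (- l * real h) * B - \<epsilon> \<le> U l \<omega>" if h: "h > N" for h :: nat
    proof -
      have "- exp (- l * real h) * B \<le> V (xi_payoff K g (U l) (real h) l) \<omega>"
      proof (rule value_ge_const[OF _ _ \<omega>])
        fix z assume z: "z \<in> K"
        have "exp (- l * t) * g (z t) \<in> {0..1}" if "t \<ge> 0" for t
          using running_unit[OF z that] l that by (auto intro!: mult_le_one)
        from set_lebesgue_integral_Icc_nonneg[OF this]
        have "0 \<le> (LINT t:{0..real h}|lborel. exp (- l * t) * g (z t))" .
        then have "0 \<le> l * (LINT t:{0..real h}|lborel. exp (- l * t) * g (z t))"
          using l by simp
        moreover have "exp (- l * real h) * (- B) \<le> exp (- l * real h) * U l (z (real h))"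
          using B[OF trajectory_in[OF z, of "real h"]] by (intro mult_left_mono) auto
        ultimately show "- exp (- l * real h) * B \<le> xi_payoff K g (U l) (real h) l z"
          using z by (simp add: xi_payoff_def)
      qed (use sup[OF h l] in blast)
      with sup[OF h l] \<omega> show ?thesis
        by force
    qed
    have "(\<lambda>h::nat. exp (- l * real h)) \<longlonglongrightarrow> 0"
      using l(1) by real_asymp
    then have "(\<lambda>h::nat. - exp (- l * real h) * B - \<epsilon>) \<longlonglongrightarrow> - 0 * B - \<epsilon>"
      by (intro tendsto_intros)
    then have "- 0 * B - \<epsilon> \<le> U l \<omega>"
      by (rule LIMSEQ_le_const2) (use ge in \<open>auto intro!: exI[of _ "Suc N"]\<close>)
    then show ?thesis by simp
  qed
  with N show ?thesis using that by blast
qed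

text \<open>With discount rate \<open>1 / n\<close> both running integrals carry the factor
  \<open>1 / n\<close>, and the terminal weights are \<open>m / n = 1 - s\<close> and
  \<open>exp (- s)\<close>. Thus \<open>one_step_estimate\<close> applies on each trajectory, and
  \<open>value_le_add\<close> lifts the bound to values.\<close>

lemma value_zeta_le_value_xi:
  fixes m h :: nat and u U :: "'w \<Rightarrow> real"
  defines "n \<equiv> real m + real h"
  defines "s \<equiv> real h / n"
  assumes "zeta_payoff K g u (real h) (real m) \<in> C" "xi_payoff K g U (real h) (1 / n) \<in> C"
    and "0 < m" "0 \<le> \<delta>"
    and "\<And>x. x \<in> \<Omega> \<Longrightarrow> u x \<le> U x + D + \<delta>" "\<And>x. x \<in> \<Omega> \<Longrightarrow> - 1 \<le> U x"
    and \<omega>: "\<omega> \<in> \<Omega>"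
  shows "V (zeta_payoff K g u (real h) (real m)) \<omega>
    \<le> V (xi_payoff K g U (real h) (1 / n)) \<omega> + ((1 - s) * D + \<delta> + 2 * s\<^sup>2)"
proof (rule value_le_add[OF assms(3,4) _ \<omega>])
  fix z assume z: "z \<in> K"
  have n: "n > 0"
    using assms by simp
  have s: "0 \<le> s" "s \<le> 1" "1 / n * real h = s" "1 - s = real m / n"
    using assms n by (auto simp: field_simps)
  have zh: "z (real h) \<in> \<Omega>"
    using trajectory_in[OF z] by simp
  have I: "(LINT t:{0..real h}|lborel. g (z t)) \<le> real h"
    using set_lebesgue_integral_Icc_le[OF running_measurable[OF z] running_unit[OF z]] by simp
  have J: "(1 - s) * (LINT t:{0..real h}|lborel. g (z t))
      \<le> (LINT t:{0..real h}|lborel. exp (- (1 / n) * t) * g (z t))"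
    using discounted_integral_ge[OF running_measurable[OF z] running_unit[OF z], of "1 / n" "real h"]
      n s(3) by simp
  have "1 / n * (LINT t:{0..real h}|lborel. g (z t)) + (1 - s) * u (z (real h))
    \<le> 1 / n * (LINT t:{0..real h}|lborel. exp (- (1 / n) * t) * g (z t))
      + exp (- s) * U (z (real h)) + ((1 - s) * D + \<delta> + 2 * s\<^sup>2)"
    by (rule one_step_estimate[OF s(1,2) _ s(3) I J]) (use n zh assms in auto)
  moreover have "zeta_payoff K g u (real h) (real m) z
      = 1 / n * (LINT t:{0..real h}|lborel. g (z t)) + (1 - s) * u (z (real h))"
    using z s(4) by (simp add: zeta_payoff_def n_def)
  moreover have "xi_payoff K g U (real h) (1 / n) z
      = 1 / n * (LINT t:{0..real h}|lborel. exp (- (1 / n) * t) * g (z t))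
        + exp (- s) * U (z (real h))"
    using z by (simp add: xi_payoff_def s_def)
  ultimately show "zeta_payoff K g u (real h) (real m) z
      \<le> xi_payoff K g U (real h) (1 / n) z + ((1 - s) * D + \<delta> + 2 * s\<^sup>2)"
    by simp
qed

end

section \<open>Iteration along integer horizons\<close>

lemma eventually_increment_le:
  fixes U :: "real \<Rightarrow> 'w \<Rightarrow> real"
  assumes "Limsup (at_right (0::real))
      (\<lambda>l. SUP p\<in>{1..p0}. SUP \<omega>\<in>\<Omega>. ereal (U (p * l) \<omega> - U l \<omega>)) \<le> 0"
    and "0 < \<epsilon>"
  obtains N :: nat where "N \<ge> 1"
    "\<And>l p \<omega>. 0 < l \<Longrightarrow> l < 1 / real N \<Longrightarrow> 1 \<le> p \<Longrightarrow> p \<le> p0 \<Longrightarrow> \<omega> \<in> \<Omega> \<Longrightarrow>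
      U (p * l) \<omega> \<le> U l \<omega> + \<epsilon>"
proof -
  have "0 < ereal \<epsilon>"
    using assms(2) by simp
  with assms(1) have "eventually (\<lambda>l. (SUP p\<in>{1..p0}. SUP \<omega>\<in>\<Omega>. ereal (U (p * l) \<omega> - U l \<omega>)) < ereal \<epsilon>)
      (at_right (0::real))"
    by (intro Limsup_lessD) (rule le_less_trans)
  then obtain b where b: "b > 0"
    and lt: "\<And>l. 0 < l \<Longrightarrow> l < b \<Longrightarrow>
      (SUP p\<in>{1..p0}. SUP \<omega>\<in>\<Omega>. ereal (U (p * l) \<omega> - U l \<omega>)) < ereal \<epsilon>"
    unfolding eventually_at_right_field by auto
  obtain N :: nat where N: "N \<noteq> 0" "inverse (real N) < b"
    using real_arch_inverse[of b] b by auto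
  show ?thesis
  proof (rule that[of N])
    fix l p \<omega> assume *: "0 < l" "l < 1 / real N" "1 \<le> p" "p \<le> p0" "\<omega> \<in> \<Omega>"
    have "ereal (U (p * l) \<omega> - U l \<omega>) \<le> (SUP \<omega>\<in>\<Omega>. ereal (U (p * l) \<omega> - U l \<omega>))"
      using * by (intro SUP_upper)
    also have "\<dots> \<le> (SUP p\<in>{1..p0}. SUP \<omega>\<in>\<Omega>. ereal (U (p * l) \<omega> - U l \<omega>))"
      using * by (intro SUP_upper) auto
    also have "\<dots> < ereal \<epsilon>"
      using * N by (intro lt) (auto simp: inverse_eq_divide)
    finally show "U (p * l) \<omega> \<le> U l \<omega> + \<epsilon>"
      by simp
  qed (use N in auto)
qed

text \<open>One step maps a bound \<open>\<epsilon> + x\<close> on the gap to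
  \<open>(1 - q) * (\<epsilon> + x) + q * \<epsilon>\<close>, that is
  \<open>\<epsilon> + (1 - q) * x\<close>. The excess \<open>x\<close> therefore decays
  geometrically.\<close>

lemma (in value_map) eventually_value_le_nat:
  assumes v: "\<forall>T>0. v_payoff K g T \<in> C"
    and super: "supersolution_w \<Omega> K g C V U"
    and sub: "subsolution_v \<Omega> K g C V (\<lambda>T. V (v_payoff K g T))"
    and lim: "Limsup (at_right (0::real))
      (\<lambda>l. SUP p\<in>{1..2}. SUP \<omega>\<in>\<Omega>. ereal (U (p * l) \<omega> - U l \<omega>)) \<le> 0"
    and \<epsilon>: "0 < \<epsilon>"
  obtains N :: nat where "\<And>n \<omega>. n \<ge> N \<Longrightarrow> \<omega> \<in> \<Omega> \<Longrightarrow>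
    V (v_payoff K g (real n)) \<omega> \<le> U (1 / real n) \<omega> + 2 * \<epsilon>"
proof -
  define W where "W = (\<lambda>T. V (v_payoff K g T))"
  \<comment> \<open>The step will be \<open>h = n div k\<close>, whose ratio
    \<open>s = h / n\<close> lies between \<open>q\<close> and \<open>2 * q\<close>. The bound
    \<open>k \<ge> 2\<close> keeps \<open>h \<le> m\<close>; the other makes the quadratic error
    \<open>2 * s^2 \<le> 8 * q^2\<close> at most half of \<open>q * \<epsilon>\<close>.\<close>
  obtain k :: nat where k: "k \<ge> 2" "8 / \<epsilon> \<le> real k"
    using real_arch_simple[of "max 2 (8 / \<epsilon>)"] by auto
  define q where "q = 1 / (2 * real k)"
  have q: "0 < q" "q < 1" "8 * q\<^sup>2 \<le> q * \<epsilon> / 2"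
  proof -
    have "8 * q \<le> \<epsilon> / 2"
      using k \<epsilon> by (simp add: q_def field_simps)
    from mult_left_mono[OF this, of q] show "8 * q\<^sup>2 \<le> q * \<epsilon> / 2"
      using k by (simp add: q_def power2_eq_square)
  qed (use k in \<open>auto simp: q_def\<close>)
  \<comment> \<open>A step loses \<open>\<delta>\<close> three times: in the subsolution inequality,
    in the supersolution inequality and in replacing \<open>U (1 / m)\<close> by
    \<open>U (1 / n)\<close>. Together this is the other half of
    \<open>q * \<epsilon>\<close>.\<close>
  define \<delta> where "\<delta> = q * \<epsilon> / 6"
  have \<delta>: "0 < \<delta>" using q \<epsilon> by (simp add: \<delta>_def)
  obtain N1 :: nat where N1: "N1 \<ge> 1"
    "\<And>l \<omega>. 0 < l \<Longrightarrow> l < 1 / real N1 \<Longrightarrow> \<omega> \<in> \<Omega> \<Longrightarrow> - 1 \<le> U l \<omega>"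
    using supersolution_lower_bound[OF super, of 1] by auto
  obtain N2 :: nat where N2: "N2 \<ge> 1"
    "\<And>l p \<omega>. 0 < l \<Longrightarrow> l < 1 / real N2 \<Longrightarrow> 1 \<le> p \<Longrightarrow> p \<le> 2 \<Longrightarrow> \<omega> \<in> \<Omega> \<Longrightarrow>
      U (p * l) \<omega> \<le> U l \<omega> + \<delta>"
    by (rule eventually_increment_le[OF lim \<delta>]) blast
  obtain N3 :: nat where N3: "N3 \<ge> 1"
    "\<And>(h::nat) l. h > N3 \<Longrightarrow> 0 < l \<Longrightarrow> l < 1 / real N3 \<Longrightarrow>
      xi_payoff K g (U l) (real h) l \<in> C \<and>
      (\<forall>\<omega>\<in>\<Omega>. U l \<omega> \<ge> V (xi_payoff K g (U l) (real h) l) \<omega> - \<delta>)"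
    using super[unfolded supersolution_w_def, THEN conjunct2, rule_format, OF \<delta>] by metis
  obtain N4 :: nat where N4:
    "\<And>h T::nat. h > N4 \<Longrightarrow> T > N4 \<Longrightarrow> zeta_payoff K g (W (real T)) (real h) (real T) \<in> C \<and>
        (\<forall>\<omega>\<in>\<Omega>. W (real T + real h) \<omega>
                \<le> V (zeta_payoff K g (W (real T)) (real h) (real T)) \<omega> + \<delta>)"
    using sub[unfolded subsolution_v_def, THEN conjunct2, rule_format, OF \<delta>] unfolding W_def by metis
  \<comment> \<open>The bound \<open>2 * M\<close> ensures \<open>m \<ge> M\<close>, since
    \<open>n \<le> 2 * m\<close>; the bound with factor \<open>k\<close> pushes \<open>h\<close>,
    and with it \<open>m\<close> and \<open>n\<close>, beyond all thresholds. \<open>IH\<close>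
    covers all states because it is applied at the terminal state \<open>z h\<close>.\<close>
  have step: "W (real n) \<omega> \<le> U (1 / real n) \<omega> + (\<epsilon> + (1 - q) * x)"
    if n: "n \<ge> 2 * M" "n \<ge> k * Suc (N1 + N2 + N3 + N4)" and x: "x \<ge> 0"
      and IH: "\<And>m \<omega>. m \<ge> M \<Longrightarrow> \<omega> \<in> \<Omega> \<Longrightarrow> W (real m) \<omega> \<le> U (1 / real m) \<omega> + (\<epsilon> + x)"
      and \<omega>: "\<omega> \<in> \<Omega>"
    for n M x \<omega>
  proof -
    define h where "h = n div k"
    define m where "m = n - h"
    have h: "h \<ge> Suc (N1 + N2 + N3 + N4)"
      using div_le_mono[OF n(2), of k] k(1) by (simp add: h_def)
    have hk: "h * k \<le> n" "n < h * k + k"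
      using k(1) dividend_less_div_times[of k n] by (simp_all add: h_def add.commute)
    have "2 * h \<le> n"
      using hk(1) k(1) mult_le_mono2[of 2 k h] by linarith
    then have m: "m + h = n" "h \<le> m" "n \<le> 2 * m" "M \<le> m"
      using n(1) by (auto simp: m_def)
    have nmh: "real n = real m + real h"
      using m(1) by auto
    have pos: "0 < m" "0 < n"
      using h m by auto
    define s where "s = real h / real n"
    have s_le: "s \<le> 2 * q"
      using hk(1) pos k(1) by (simp add: s_def q_def field_simps flip: of_nat_mult)
    \<comment> \<open>Rounding in \<open>n div k\<close> costs at most a factor 2, because
      \<open>h\<close> is at least 1.\<close>
    have s_ge: "q \<le> s"
    proof -
      have "k \<le> h * k"
        using h by simp
      then have "n \<le> 2 * (h * k)"
        using hk(2) by linarith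
      then have "real n \<le> 2 * (real h * real k)"
        by (simp flip: of_nat_mult)
      then show ?thesis
        using pos k(1) by (simp add: s_def q_def field_simps)
    qed
    have small: "0 < 1 / real n" "1 / real n < 1 / real N1" "1 / real n < 1 / real N2"
      "1 / real n < 1 / real N3"
      using h m N1(1) N2(1) N3(1) by (auto intro!: divide_strict_left_mono)
    have u: "W (real m) y \<le> U (1 / real n) y + (\<epsilon> + x) + \<delta>" if "y \<in> \<Omega>" for y
    proof -
      \<comment> \<open>The ratio \<open>p = n / m\<close> lies in \<open>{1..2}\<close> and turns
        the rate \<open>1 / n\<close> into \<open>1 / m\<close>, at which \<open>IH\<close>
        speaks.\<close>
      have "U ((real n / real m) * (1 / real n)) y \<le> U (1 / real n) y + \<delta>"
        using small m pos that by (intro N2(2)) (auto simp: field_simps)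
      moreover have "(real n / real m) * (1 / real n) = 1 / real m"
        using pos by simp
      ultimately show ?thesis
        using IH[OF m(4) that] by simp
    qed
    have zeta: "zeta_payoff K g (W (real m)) (real h) (real m) \<in> C"
      "W (real n) \<omega> \<le> V (zeta_payoff K g (W (real m)) (real h) (real m)) \<omega> + \<delta>"
      using N4[of h m] h m(2) \<omega> by (auto simp: nmh)
    have xi: "xi_payoff K g (U (1 / real n)) (real h) (1 / real n) \<in> C"
      "V (xi_payoff K g (U (1 / real n)) (real h) (1 / real n)) \<omega> \<le> U (1 / real n) \<omega> + \<delta>"
      using N3(2)[of h "1 / real n"] h small \<omega> by (auto simp: algebra_simps)
    have "V (zeta_payoff K g (W (real m)) (real h) (real m)) \<omega>
      \<le> V (xi_payoff K g (U (1 / real n)) (real h) (1 / real n)) \<omega>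
        + ((1 - s) * (\<epsilon> + x) + \<delta> + 2 * s\<^sup>2)"
      using value_zeta_le_value_xi[of "W (real m)" h m "U (1 / real n)" \<delta> "\<epsilon> + x" \<omega>]
        zeta(1) xi(1) pos \<delta> u N1(2)[OF small(1,2)] \<omega> by (simp add: nmh s_def)
    moreover have "(1 - s) * (\<epsilon> + x) \<le> (1 - q) * (\<epsilon> + x)"
      using s_ge x \<epsilon> by (intro mult_right_mono) auto
    moreover have "2 * s\<^sup>2 \<le> q * \<epsilon> / 2"
    proof -
      have "s\<^sup>2 \<le> (2 * q)\<^sup>2"
        using s_le s_ge q by (intro power_mono) auto
      then show ?thesis
        using q(3) by (simp add: power2_eq_square)
    qed
    ultimately have "W (real n) \<omega> \<le> U (1 / real n) \<omega> + ((1 - q) * (\<epsilon> + x) + 3 * \<delta> + q * \<epsilon> / 2)"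
      using zeta(2) xi(2) by linarith
    also have "(1 - q) * (\<epsilon> + x) + 3 * \<delta> + q * \<epsilon> / 2 = \<epsilon> + (1 - q) * x"
      by (simp add: \<delta>_def field_simps)
    finally show ?thesis .
  qed
  have iter: "\<exists>M. \<forall>n\<ge>M. \<forall>\<omega>\<in>\<Omega>.
      W (real n) \<omega> \<le> U (1 / real n) \<omega> + (\<epsilon> + (1 - q) ^ j * 2)" for j :: nat
  proof (induction j)
    case 0
    \<comment> \<open>The initial excess 2 is the distance between the upper bound 1 for
      \<open>W\<close> and the lower bound -1 for \<open>U\<close>.\<close>
    have "W (real n) \<omega> \<le> U (1 / real n) \<omega> + (\<epsilon> + 2)" if "n \<ge> Suc N1" "\<omega> \<in> \<Omega>" for n \<omega>
    proof -
      have "W (real n) \<omega> \<le> 1"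
        unfolding W_def using v that by (intro value_v_payoff_le_one) auto
      moreover have "- 1 \<le> U (1 / real n) \<omega>"
        using that N1(1) by (intro N1(2)) (auto intro!: divide_strict_left_mono)
      ultimately show ?thesis
        using \<epsilon> by linarith
    qed
    then show ?case by auto
  next
    case (Suc j)
    then obtain M where M: "\<And>n \<omega>. n \<ge> M \<Longrightarrow> \<omega> \<in> \<Omega> \<Longrightarrow>
      W (real n) \<omega> \<le> U (1 / real n) \<omega> + (\<epsilon> + (1 - q) ^ j * 2)"
      by blast
    have x: "0 \<le> (1 - q) ^ j * 2"
      using q by simp
    show ?case
      unfolding power_Suc mult.assoc
      by (intro exI[of _ "max (2 * M) (k * Suc (N1 + N2 + N3 + N4))"] allI ballI impI
          step[OF _ _ x M]) (simp_all only: max.bounded_iff)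
  qed
  obtain j :: nat where j: "(1 - q) ^ j < \<epsilon> / 2"
    using real_arch_pow_inv[of "\<epsilon> / 2" "1 - q"] q \<epsilon> by auto
  obtain M where M: "\<And>n \<omega>. n \<ge> M \<Longrightarrow> \<omega> \<in> \<Omega> \<Longrightarrow>
      W (real n) \<omega> \<le> U (1 / real n) \<omega> + (\<epsilon> + (1 - q) ^ j * 2)"
    using iter[of j] by blast
  show ?thesis
  proof (rule that[of M])
    fix n \<omega> assume "n \<ge> M" "\<omega> \<in> \<Omega>"
    from M[OF this] j show "V (v_payoff K g (real n)) \<omega> \<le> U (1 / real n) \<omega> + 2 * \<epsilon>"
      by (simp add: W_def)
  qed
qed

section \<open>Passage from integer to real horizons\<close>

theorem proposition4:
  fixes \<Omega> :: "'w set"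
    and K :: "(real \<Rightarrow> 'w) set"
    and g :: "'w \<Rightarrow> real"
    and C :: "((real \<Rightarrow> 'w) \<Rightarrow> real) set"
    and V :: "((real \<Rightarrow> 'w) \<Rightarrow> real) \<Rightarrow> 'w \<Rightarrow> real"
    and U :: "real \<Rightarrow> 'w \<Rightarrow> real"
  assumes "trajectory_setting \<Omega> K g"
    and "payoff_class K C"
    and "game_value_map \<Omega> K C V"
    and "\<forall>T>0. v_payoff K g T \<in> C"
    and "\<forall>l>0. w_payoff K g l \<in> C"
    and "supersolution_w \<Omega> K g C V U"
    and "subsolution_v \<Omega> K g C V (\<lambda>T. V (v_payoff K g T))"
    and "\<forall>p0::real>1.
           Limsup (at_right (0::real))
             (\<lambda>l. SUP p\<in>{1..p0}. SUP \<omega>\<in>\<Omega>. ereal (U (p * l) \<omega> - U l \<omega>)) \<le> 0"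
  shows "\<forall>\<epsilon>>0. \<exists>N::nat. \<forall>\<omega>\<in>\<Omega>. \<forall>T::real. T > real N \<longrightarrow>
           V (v_payoff K g T) \<omega> \<le> U (1 / T) \<omega> + \<epsilon>"
proof (intro allI impI)
  interpret value_map \<Omega> K g C V
    using assms by unfold_locales
  fix \<epsilon> :: real assume "0 < \<epsilon>"
  \<comment> \<open>Two quarters go to the integer horizon \<open>n\<close>, one to shortening
    \<open>T\<close> to \<open>n\<close>, one to moving from rate \<open>1 / n\<close> to
    \<open>1 / T\<close>.\<close>
  then have \<epsilon>: "0 < \<epsilon> / 4" by simp
  have lim: "Limsup (at_right (0::real))
      (\<lambda>l. SUP p\<in>{1..2}. SUP \<omega>\<in>\<Omega>. ereal (U (p * l) \<omega> - U l \<omega>)) \<le> 0"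
    using assms(8) by simp
  obtain N1 :: nat where N1: "\<And>n \<omega>. n \<ge> N1 \<Longrightarrow> \<omega> \<in> \<Omega> \<Longrightarrow>
    V (v_payoff K g (real n)) \<omega> \<le> U (1 / real n) \<omega> + 2 * (\<epsilon> / 4)"
    by (rule eventually_value_le_nat[OF assms(4,6,7) lim \<epsilon>]) blast
  obtain N2 :: nat where N2: "N2 \<ge> 1"
    "\<And>l p \<omega>. 0 < l \<Longrightarrow> l < 1 / real N2 \<Longrightarrow> 1 \<le> p \<Longrightarrow> p \<le> 2 \<Longrightarrow> \<omega> \<in> \<Omega> \<Longrightarrow>
      U (p * l) \<omega> \<le> U l \<omega> + \<epsilon> / 4"
    by (rule eventually_increment_le[OF lim \<epsilon>]) blast
  obtain N3 :: nat where N3: "4 / \<epsilon> \<le> real N3"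
    using real_arch_simple by blast
  show "\<exists>N::nat. \<forall>\<omega>\<in>\<Omega>. \<forall>T::real. T > real N \<longrightarrow> V (v_payoff K g T) \<omega> \<le> U (1 / T) \<omega> + \<epsilon>"
  proof (intro exI[of _ "Suc (N1 + N2 + N3)"] ballI allI impI)
    fix \<omega> and T :: real assume \<omega>: "\<omega> \<in> \<Omega>" and T: "T > real (Suc (N1 + N2 + N3))"
    define n where "n = nat \<lfloor>T\<rfloor>"
    have n: "real n \<le> T" "T \<le> real n + 1" "n \<ge> Suc (N1 + N2 + N3)"
      using T unfolding n_def by linarith+
    have pos: "0 < real n" "0 < T"
      using n by auto
    have "V (v_payoff K g T) \<omega> \<le> V (v_payoff K g (real n)) \<omega> + (T - real n) / real n"
      using assms(4) pos n \<omega> by (intro value_v_payoff_le_shorter) auto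
    also have "(T - real n) / real n \<le> 1 / real n"
      using n by (intro divide_right_mono) auto
    also have "1 / real n \<le> \<epsilon> / 4"
    proof -
      have "4 / \<epsilon> \<le> real n"
        using N3 n(3) by linarith
      then show ?thesis
        using \<epsilon> pos by (simp add: field_simps)
    qed
    also have "V (v_payoff K g (real n)) \<omega> \<le> U (1 / real n) \<omega> + 2 * (\<epsilon> / 4)"
      using n \<omega> by (intro N1) auto
    also have "U (1 / real n) \<omega> \<le> U (1 / T) \<omega> + \<epsilon> / 4"
    proof -
      \<comment> \<open>Here \<open>p = T / n\<close> is at most 2 because
        \<open>T \<le> n + 1\<close> and \<open>n \<ge> 1\<close>.\<close>
      have "U ((T / real n) * (1 / T)) \<omega> \<le> U (1 / T) \<omega> + \<epsilon> / 4"
      proof (rule N2(2)[OF _ _ _ _ \<omega>])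
        show "1 / T < 1 / real N2"
          using N2(1) n by (intro divide_strict_left_mono) auto
        show "T / real n \<le> 2"
          using n pos by (simp add: field_simps)
      qed (use n pos in \<open>auto simp: field_simps\<close>)
      then show ?thesis using pos by simp
    qed
    finally show "V (v_payoff K g T) \<omega> \<le> U (1 / T) \<omega> + \<epsilon>"
      by simp
  qed
qed

end
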